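(* Let $\mu$ be a probability measure on $\mathbb{R}_+=[0,\infty)$ with $\mu_{\max}=\infty$ (unbounded support), let $r\in(0,1)$, and let $\nu_\infty=\lim_{t\to\infty}\nu^*_t$ be the almost sure weak limit of the empirical distributions of the quantile admission process with veto power with parameters $\mu,r$. Then, almost surely, $$\lim_{s\to\infty}\frac{\log\nu_\infty((s,\infty))}{\log\mu((s,\infty))}=2.$$
   Context: Process. Let $(X_t,Y_t)_{t\ge 1}$ be independent pairs of independent $\mu$-distributed random variables. Let $\mathcal{S}_0=\emptyset$, a multiset of reals. For $t\ge1$: if $\#\{s\in\mathcal{S}_{t-1}: s\le \frac{X_t+Y_t}{2}\}\ge r|\mathcal{S}_{t-1}|$ (counted with multiplicity), then $\mathcal{S}_t$ is $\mathcal{S}_{t-1}$ with one additional copy of $\min(X_t,Y_t)$; otherwise $\mathcal{S}_t=\mathcal{S}_{t-1}$. For $t\ge 1$ put $\nu^*_t=\frac{1}{|\mathcal{S}_t|}\sum_{s\in\mathcal{S}_t}\delta_s$. It is known that for every probability measure $\mu$ on $\mathbb{R}_+$ and $r\in(0,1)$, $\nu^*_t$ converges weakly almost surely to a (possibly random) probability measure $\nu_\infty$. $\mu_{\max}$ denotes the supremum of the support of $\mu$. *)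

theory Defs
  imports "HOL-Probability.Probability"
begin

definition supp :: "real measure \<Rightarrow> real set" where
  "supp \<mu> = {x. \<forall>U. open U \<longrightarrow> x \<in> U \<longrightarrow> emeasure \<mu> U > 0}"

definition mu_max :: "real measure \<Rightarrow> ereal" where
  "mu_max \<mu> = (SUP x\<in>supp \<mu>. ereal x)"

text \<open>
  The multiset of admitted values for fixed candidate sequences \<open>x\<close>, \<open>y\<close>.
  The candidates of step \<open>t\<close> are \<open>x t\<close> and \<open>y t\<close> for \<open>t \<ge> 1\<close>; the values
  \<open>x 0\<close> and \<open>y 0\<close> are never used.
\<close>

primrec admitted :: "real \<Rightarrow> (nat \<Rightarrow> real) \<Rightarrow> (nat \<Rightarrow> real) \<Rightarrow> nat \<Rightarrow> real multiset" where
  "admitted r x y 0 = {#}"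
| "admitted r x y (Suc t) =
    (let S = admitted r x y t in
      if real (size {#s \<in># S. s \<le> (x (Suc t) + y (Suc t)) / 2#}) \<ge> r * real (size S)
      then add_mset (min (x (Suc t)) (y (Suc t))) S
      else S)"

text \<open>
  The empirical distribution is a measure on the Borel sets. It is unspecified for the empty
  multiset, which among the sets of admitted values occurs only at time 0.
\<close>

definition empirical :: "real multiset \<Rightarrow> real measure" where
  "empirical S = distr (measure_pmf (pmf_of_multiset S)) borel (\<lambda>s. s)"

lemma admitted_Suc_nonempty: "admitted r x y (Suc t) \<noteq> {#}"
  by (induction t) (simp_all add: Let_def)

lemma measure_empirical:
  assumes "S \<noteq> {#}" "A \<in> sets borel"
  shows "measure (empirical S) A = real (size {#s \<in># S. s \<in> A#}) / real (size S)"
proof -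
  have "measure (empirical S) A = measure (measure_pmf (pmf_of_multiset S)) A"
    using assms(2) by (simp add: empirical_def measure_distr)
  also have "\<dots> = measure (measure_pmf (pmf_of_multiset S)) (A \<inter> set_mset S)"
    using measure_Int_set_pmf[of "pmf_of_multiset S" A] assms(1) by simp
  also have "\<dots> = (\<Sum>s\<in>A \<inter> set_mset S. real (count S s) / real (size S))"
    using assms(1) by (simp add: measure_measure_pmf_finite)
  also have "\<dots> = real (\<Sum>s\<in>A \<inter> set_mset S. count S s) / real (size S)"
    by (simp add: sum_divide_distrib)
  also have "(\<Sum>s\<in>A \<inter> set_mset S. count S s) = size {#s \<in># S. s \<in> A#}"
    unfolding size_multiset_overloaded_eq
    by (rule sum.cong) auto
  finally show ?thesis .
qed

end

theory Submission
  imports Defs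
begin

text \<open>
  Write \<open>G s = \<mu> (s, \<infinity>)\<close>. The limit \<open>\<nu>\<close> has a tail comparable to \<open>G\<^sup>2\<close>: almost surely there are
  random \<open>K\<close> and \<open>C\<close> with \<open>(G s)\<^sup>2 \<le> \<nu> (s, \<infinity>) \<le> C (G s)\<^sup>2\<close> for all \<open>s \<ge> K\<close>. Taking logarithms, and
  using that \<open>ln (G s)\<close> tends to \<open>-\<infinity>\<close>, gives the ratio 2; unbounded support makes \<open>G\<close>
  positive, so that these logarithms are meaningful.

  The comparison needs no information on where the admission threshold goes, only that it stays
  bounded. The admitted value \<open>min (X\<^sub>t) (Y\<^sub>t)\<close> exceeds \<open>s\<close> only if both candidates do, an event of
  probability \<open>(G s)\<^sup>2\<close>. Conversely, since the empirical distributions converge weakly and \<open>r < 1\<close>,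
  from some time on at least a fraction \<open>r\<close> of the admitted values lies below a fixed \<open>K\<close>; then
  every pair with \<open>min (X\<^sub>t) (Y\<^sub>t) > s \<ge> K\<close> has its average above \<open>K\<close> and is admitted. So for \<open>s \<ge> K\<close>
  the number of admitted values above \<open>s\<close> equals, up to a bounded error, the number of pairs with
  minimum above \<open>s\<close> (\<open>size_admitted_above_le\<close>, \<open>size_admitted_above_ge\<close>), and this is
  asymptotically \<open>t (G s)\<^sup>2\<close> by the strong law of large numbers (\<open>strong_law_relative_frequency\<close>).
  The total number of admitted values is at most \<open>t\<close>, and at least of order \<open>t (G K)\<^sup>2\<close> by the same
  count at \<open>s = K\<close>. Dividing gives the two bounds with \<open>C = 1 / (G K)\<^sup>2\<close>.

  The strong law is applied at rational levels only, so that one null set suffices; right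
  continuity of the tails extends the bounds to all levels (\<open>limit_tail_comparable\<close>).
\<close>

section \<open>Counting admitted values above a level\<close>

lemma size_admitted_le: "size (admitted r x y t) \<le> t"
  by (induction t) (auto simp: Let_def)

lemma card_hits_Suc:
  "card {i \<in> {1..Suc t}. P i} = card {i \<in> {1..t}. P i} + (if P (Suc t) then 1 else 0)"
proof -
  have "{i \<in> {1..Suc t}. P i} = {i \<in> {1..t}. P i} \<union> (if P (Suc t) then {Suc t} else {})"
    by (auto simp: le_Suc_eq)
  then show ?thesis
    by (simp add: card_insert_if)
qed

lemma size_admitted_above_le:
  "size {#a \<in># admitted r x y t. s < a#} \<le> card {i \<in> {1..t}. s < min (x i) (y i)}"
proof (induction t)
  case (Suc t)
  then show ?case
    unfolding card_hits_Suc by (auto simp: Let_def)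
qed simp

text \<open>
  When at least a fraction \<open>r\<close> of the admitted values is at most \<open>K\<close>, a pair whose minimum exceeds \<open>K\<close> has its
  average above \<open>K\<close> and passes the test. So after time \<open>t0\<close> no pair with minimum above \<open>s \<ge> K\<close> is
  rejected, and the earlier ones number at most \<open>t0\<close>.
\<close>

lemma size_admitted_above_ge:
  assumes low: "\<And>t. t \<ge> t0 \<Longrightarrow>
      r * real (size (admitted r x y t)) \<le> real (size {#a \<in># admitted r x y t. a \<le> K#})"
    and "K \<le> s"
  shows "card {i \<in> {1..t}. s < min (x i) (y i)} \<le> size {#a \<in># admitted r x y t. s < a#} + t0"
proof (induction t)
  case 0
  then show ?case by simp
next
  case (Suc t)
  let ?S = "admitted r x y t"
  consider (early) "Suc t \<le> t0" | (no_hit) "\<not> s < min (x (Suc t)) (y (Suc t))"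
    | (hit) "t0 \<le> t" "s < min (x (Suc t)) (y (Suc t))"
    by linarith
  then show ?case
  proof cases
    case early
    have "card {i \<in> {1..Suc t}. s < min (x i) (y i)} \<le> card {1..Suc t}"
      by (intro card_mono) auto
    then show ?thesis using early by simp
  next
    case no_hit
    have "size {#a \<in># ?S. s < a#} \<le> size {#a \<in># admitted r x y (Suc t). s < a#}"
      by (auto simp: Let_def)
    then show ?thesis using Suc no_hit by (simp only: card_hits_Suc if_False)
  next
    case hit
    have "size {#a \<in># ?S. a \<le> K#} \<le> size {#a \<in># ?S. a \<le> (x (Suc t) + y (Suc t)) / 2#}"
      using hit(2) \<open>K \<le> s\<close> by (intro size_mset_mono filter_mset_mono_strong) auto
    then have "r * real (size ?S) \<le> real (size {#a \<in># ?S. a \<le> (x (Suc t) + y (Suc t)) / 2#})"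
      using low[OF hit(1)] by linarith
    then have "admitted r x y (Suc t) = add_mset (min (x (Suc t)) (y (Suc t))) ?S"
      by (simp add: Let_def)
    then show ?thesis using Suc hit(2) by (simp only: card_hits_Suc) simp
  qed
qed

section \<open>Frequencies of pairs with large minimum\<close>

text \<open>
  By Hoeffding's inequality, the probability of a deviation by \<open>\<epsilon>\<close> decays geometrically in the number
  of trials, hence is summable, and the Borel-Cantelli lemma applies to each \<open>\<epsilon> = 1 / (k + 1)\<close>.
\<close>

lemma (in prob_space) strong_law_relative_frequency:
  assumes indep: "indep_vars (\<lambda>_. N) Z {1..}"
    and [measurable]: "A \<in> sets N"
    and p: "\<And>i. i \<ge> 1 \<Longrightarrow> prob {\<omega> \<in> space M. Z i \<omega> \<in> A} = p"
  shows "AE \<omega> in M. (\<lambda>n. real (card {i \<in> {1..n}. Z i \<omega> \<in> A}) / real n) \<longlonglongrightarrow> p"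
proof -
  define B where "B i \<omega> = (indicator A (Z i \<omega>) :: real)" for i \<omega>
  have rv [measurable]: "Z i \<in> measurable M N" if "i \<ge> 1" for i
    using indep that by (auto simp: indep_vars_def)
  have indep_B: "indep_vars (\<lambda>_. borel) B {1..}"
    unfolding B_def by (intro indep_vars_compose2[OF indep]) measurable
  have exp_B: "expectation (B i) = p" if "i \<ge> 1" for i
  proof -
    have "expectation (B i) = expectation (indicator {\<omega> \<in> space M. Z i \<omega> \<in> A})"
      unfolding B_def by (intro Bochner_Integration.integral_cong) (auto split: split_indicator)
    also have "\<dots> = p"
      using p[OF that] by (simp add: Collect_conj_eq Int_ac)
    finally show ?thesis .
  qed
  have sum_B: "(\<Sum>i=1..n. B i \<omega>) = real (card {i \<in> {1..n}. Z i \<omega> \<in> A})" for n \<omega>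
    by (simp add: B_def indicator_def of_bool_def sum.If_cases Int_def)
  have deviation: "AE \<omega> in M. \<forall>\<^sub>F n in sequentially.
      \<bar>real (card {i \<in> {1..n}. Z i \<omega> \<in> A}) / real n - p\<bar> < \<epsilon>" if "\<epsilon> > 0" for \<epsilon>
  proof -
    define E where "E n = (if n = 0 then {} else
      {\<omega> \<in> space M. \<bar>(\<Sum>i=1..n. B i \<omega>) - real n * p\<bar> \<ge> \<epsilon> * real n})" for n
    have [measurable]: "B i \<in> borel_measurable M" if "i \<ge> 1" for i
      using indep_B that by (auto simp: indep_vars_def)
    have E: "E n \<in> sets M" for n
    proof -
      have [measurable]: "(\<lambda>\<omega>. \<Sum>i=1..n. B i \<omega>) \<in> borel_measurable M"
        by (intro borel_measurable_sum) auto
      show ?thesis by (auto simp: E_def)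
    qed
    have bound: "prob (E n) \<le> 2 * exp (-2 * \<epsilon>\<^sup>2) ^ n" for n
    proof (cases "n = 0")
      case False
      interpret H: Hoeffding_ineq M "{1..n}" B "\<lambda>_. 0" "\<lambda>_. 1" "\<Sum>i=1..n. expectation (B i)"
      proof unfold_locales
        show "indep_vars (\<lambda>_. borel) B {1..n}"
          by (rule indep_vars_subset[OF indep_B]) auto
      qed (auto simp: B_def split: split_indicator)
      have "prob {\<omega> \<in> space M. \<bar>(\<Sum>i=1..n. B i \<omega>) - (\<Sum>i=1..n. expectation (B i))\<bar> \<ge> \<epsilon> * real n}
          \<le> 2 * exp (-2 * (\<epsilon> * real n)\<^sup>2 / (\<Sum>i=1..n. (1 - 0)\<^sup>2))"
        using False \<open>\<epsilon> > 0\<close> by (intro H.Hoeffding_ineq_abs_ge) auto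
      moreover have "-2 * (\<epsilon> * real n)\<^sup>2 / real n = real n * (-2 * \<epsilon>\<^sup>2)"
        using False by (simp add: power2_eq_square)
      ultimately show ?thesis
        using False exp_B by (simp add: E_def flip: exp_of_nat_mult)
    qed (simp add: E_def)
    have "summable (\<lambda>n. 2 * exp (-2 * \<epsilon>\<^sup>2) ^ n)"
      using \<open>\<epsilon> > 0\<close> by (intro summable_mult summable_geometric) auto
    then have "summable (\<lambda>n. prob (E n))"
      by (rule summable_comparison_test') (use bound in simp)
    then have "AE \<omega> in M. \<forall>\<^sub>F n in sequentially. \<omega> \<in> space M - E n"
      using E by (intro borel_cantelli_AE1) (auto simp: emeasure_eq_measure)
    then show ?thesis
    proof (rule AE_mp, intro AE_I2 impI)
      fix \<omega> assume "\<forall>\<^sub>F n in sequentially. \<omega> \<in> space M - E n"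
      then show "\<forall>\<^sub>F n in sequentially. \<bar>real (card {i \<in> {1..n}. Z i \<omega> \<in> A}) / real n - p\<bar> < \<epsilon>"
        using eventually_gt_at_top[of 0]
      proof eventually_elim
        case (elim n)
        let ?c = "real (card {i \<in> {1..n}. Z i \<omega> \<in> A})"
        have "\<bar>?c - real n * p\<bar> < \<epsilon> * real n"
          using elim sum_B[of \<omega> n] by (auto simp: E_def)
        moreover have "?c / real n - p = (?c - real n * p) / real n"
          using elim(2) by (simp add: diff_divide_distrib)
        ultimately show ?case
          using elim(2) by (simp only: abs_divide abs_of_nat) (simp add: divide_less_eq)
      qed
    qed
  qed
  have "AE \<omega> in M. \<forall>k. \<forall>\<^sub>F n in sequentially.
      \<bar>real (card {i \<in> {1..n}. Z i \<omega> \<in> A}) / real n - p\<bar> < 1 / real (Suc k)"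
    unfolding AE_all_countable by (intro allI deviation) simp
  then show ?thesis
  proof (rule AE_mp, intro AE_I2 impI)
    fix \<omega> assume all: "\<forall>k. \<forall>\<^sub>F n in sequentially.
      \<bar>real (card {i \<in> {1..n}. Z i \<omega> \<in> A}) / real n - p\<bar> < 1 / real (Suc k)"
    show "(\<lambda>n. real (card {i \<in> {1..n}. Z i \<omega> \<in> A}) / real n) \<longlonglongrightarrow> p"
    proof (rule tendstoI)
      fix e :: real assume "e > 0"
      then obtain k where k: "1 / real (Suc k) < e"
        using nat_approx_posE by blast
      show "\<forall>\<^sub>F n in sequentially. dist (real (card {i \<in> {1..n}. Z i \<omega> \<in> A}) / real n) p < e"
        using all[rule_format, of k] by eventually_elim (use k in \<open>auto simp: dist_real_def\<close>)
    qed
  qed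
qed

lemma (in prob_space) prob_min_greater:
  fixes X Y :: "'a \<Rightarrow> real"
  assumes indep: "indep_var borel X borel Y" and "distr M borel X = \<mu>" "distr M borel Y = \<mu>"
  shows "prob {\<omega> \<in> space M. s < min (X \<omega>) (Y \<omega>)} = (measure \<mu> {s<..})\<^sup>2"
proof -
  have [measurable]: "random_variable borel X" "random_variable borel Y"
    using indep by (auto dest: indep_var_rv1 indep_var_rv2)
  have "{\<omega> \<in> space M. s < min (X \<omega>) (Y \<omega>)}
      = (\<lambda>\<omega>. (X \<omega>, Y \<omega>)) -` ({s<..} \<times> {s<..}) \<inter> space M"
    by auto
  then have "prob {\<omega> \<in> space M. s < min (X \<omega>) (Y \<omega>)}
      = prob (X -` {s<..} \<inter> space M) * prob (Y -` {s<..} \<inter> space M)"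
    using indep_varD[OF indep, of "{s<..}" "{s<..}"] by simp
  also have "prob (X -` {s<..} \<inter> space M) = measure \<mu> {s<..}"
    using assms(2) by (auto simp: measure_distr)
  also have "prob (Y -` {s<..} \<inter> space M) = measure \<mu> {s<..}"
    using assms(3) by (auto simp: measure_distr)
  finally show ?thesis by (simp add: power2_eq_square)
qed

section \<open>Tails of distributions on the real line\<close>

lemma (in real_distribution) tail_eq_cdf: "measure M {u<..} = 1 - cdf M u"
proof -
  have "UNIV - {..u} = {u<..}" by auto
  then show ?thesis
    using prob_compl[of "{..u}"] by (simp add: cdf_def)
qed

lemma (in real_distribution) tail_antimono: "u \<le> v \<Longrightarrow> measure M {v<..} \<le> measure M {u<..}"
  by (intro finite_measure_mono) auto

lemma (in real_distribution) tail_at_right: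
  "((\<lambda>v. measure M {v<..}) \<longlongrightarrow> measure M {u<..}) (at_right u)"
  using cdf_is_right_cont[of u] unfolding continuous_within tail_eq_cdf
  by (intro tendsto_intros)

lemma (in real_distribution) tail_at_top: "((\<lambda>v. measure M {v<..}) \<longlongrightarrow> 0) at_top"
  using tendsto_diff[OF tendsto_const[of 1] cdf_lim_at_top_prob] by (simp add: tail_eq_cdf)

lemma (in real_distribution) ex_isCont_cdf_between:
  assumes "a < b"
  obtains w where "a < w" "w < b" "isCont (cdf M) w"
  using open_minus_countable[OF countable_atoms, of "{a<..<b}"] assms isCont_cdf
  by (auto simp: zero_less_measure_iff measure_le_0_iff)

lemma tail_pos_of_mu_max:
  assumes "mu_max \<mu> = \<infinity>" "real_distribution \<mu>"
  shows "0 < measure \<mu> {u<..}"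
proof -
  interpret real_distribution \<mu> by fact
  have "ereal u < (SUP x\<in>supp \<mu>. ereal x)"
    using assms(1) by (simp add: mu_max_def)
  then obtain x where "x \<in> supp \<mu>" "u < x"
    by (auto simp: less_SUP_iff)
  then have "emeasure \<mu> {u<..} > 0"
    by (auto simp: supp_def)
  then show ?thesis
    by (simp add: emeasure_eq_measure)
qed

lemma real_distribution_empirical: "S \<noteq> {#} \<Longrightarrow> real_distribution (empirical S)"
  unfolding empirical_def
  by (intro prob_space.real_distribution_distr measure_pmf.prob_space_axioms) auto

lemma tail_empirical_tendsto:
  assumes "weak_conv_m (\<lambda>t. empirical (admitted r x y t)) \<nu>" "real_distribution \<nu>" "isCont (cdf \<nu>) w"
  shows "(\<lambda>t. real (size {#a \<in># admitted r x y t. w < a#}) / real (size (admitted r x y t)))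
    \<longlonglongrightarrow> measure \<nu> {w<..}"
proof -
  have "(\<lambda>t. 1 - cdf (empirical (admitted r x y t)) w) \<longlonglongrightarrow> 1 - cdf \<nu> w"
    using assms by (intro tendsto_intros) (auto simp: weak_conv_m_def weak_conv_def)
  moreover have "\<forall>\<^sub>F t in sequentially. 1 - cdf (empirical (admitted r x y t)) w =
      real (size {#a \<in># admitted r x y t. w < a#}) / real (size (admitted r x y t))"
    using eventually_gt_at_top[of 0]
  proof eventually_elim
    case (elim t)
    then have ne: "admitted r x y t \<noteq> {#}"
      using admitted_Suc_nonempty by (cases t) auto
    show ?case
      using real_distribution.tail_eq_cdf[OF real_distribution_empirical[OF ne], of w]
      by (simp add: measure_empirical[OF ne])
  qed
  ultimately show ?thesis
    using real_distribution.tail_eq_cdf[OF assms(2)] by (simp add: tendsto_cong)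
qed

section \<open>The tail of the limit distribution\<close>

text \<open>
  The pathwise core of the argument. Levels of three kinds alternate here: the counting bounds hold
  at rational levels \<open>q\<close>, weak convergence gives information at continuity points \<open>w\<close> of \<open>\<nu>\<close>, and
  the conclusion concerns arbitrary \<open>u\<close>. The tails being monotone, it suffices to interpose a
  rational and a continuity point between \<open>u\<close> and any \<open>v > u\<close>, and then to let \<open>v\<close> decrease to \<open>u\<close>.
\<close>

lemma limit_tail_comparable:
  fixes G :: "real \<Rightarrow> real"
  assumes "real_distribution \<nu>" and conv: "weak_conv_m (\<lambda>t. empirical (admitted r x y t)) \<nu>"
    and "r < 1"
    and freq: "\<And>q. q \<in> \<rat> \<Longrightarrow>
      (\<lambda>t. real (card {i \<in> {1..t}. q < min (x i) (y i)}) / real t) \<longlonglongrightarrow> (G q)\<^sup>2"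
    and G_anti: "\<And>u v. u \<le> v \<Longrightarrow> G v \<le> G u"
    and G_pos: "\<And>u. 0 < G u"
    and G_right: "\<And>u. (G \<longlongrightarrow> G u) (at_right u)"
  obtains K C where "C > 0"
    "\<And>u. K \<le> u \<Longrightarrow> (G u)\<^sup>2 \<le> measure \<nu> {u<..}"
    "\<And>u. K \<le> u \<Longrightarrow> measure \<nu> {u<..} \<le> C * (G u)\<^sup>2"
proof -
  interpret nu: real_distribution \<nu> by fact
  define hits where "hits q t = card {i \<in> {1..t}. q < min (x i) (y i)}" for q t
  define above where "above w t = size {#a \<in># admitted r x y t. w < a#}" for w t
  define sz where "sz t = size (admitted r x y t)" for t
  have hits: "(\<lambda>t. real (hits q t) / real t) \<longlonglongrightarrow> (G q)\<^sup>2" if "q \<in> \<rat>" for q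
    using freq[OF that] by (simp add: hits_def)
  have tail: "(\<lambda>t. real (above w t) / real (sz t)) \<longlonglongrightarrow> measure \<nu> {w<..}" if "isCont (cdf \<nu>) w" for w
    using tail_empirical_tendsto[OF conv \<open>real_distribution \<nu>\<close> that] by (simp add: above_def sz_def)
  have sz_pos: "sz t > 0" if "t > 0" for t
    using admitted_Suc_nonempty[of r x y "t - 1"] that
    by (simp add: sz_def nonempty_has_size del: admitted.simps)
  have sz_le: "sz t \<le> t" for t
    by (simp add: sz_def size_admitted_le)
  have above_sz: "above w t \<le> sz t" for w t
    by (simp add: above_def sz_def size_mset_mono)
  have above_anti: "above w' t \<le> above w t" if "w \<le> w'" for w w' t
    unfolding above_def using that by (intro size_mset_mono filter_mset_mono_strong) auto
  have above_le: "above w t \<le> hits w t" for w t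
    unfolding above_def hits_def by (rule size_admitted_above_le)

  \<comment> \<open>The threshold stays below \<open>K\<close>: less than a fraction \<open>1 - r\<close> of the limit lies above the
    continuity point \<open>k1\<close>, so the same is eventually true of the admitted values.\<close>
  have "\<forall>\<^sub>F u in at_top. cdf \<nu> u > r"
    using order_tendstoD(1)[OF nu.cdf_lim_at_top_prob \<open>r < 1\<close>] .
  then obtain k0 where k0: "\<And>u. u \<ge> k0 \<Longrightarrow> cdf \<nu> u > r"
    by (auto simp: eventually_at_top_linorder)
  obtain k1 where k1: "k0 < k1" "isCont (cdf \<nu>) k1"
    using nu.ex_isCont_cdf_between[of k0 "k0 + 1"] by auto
  obtain K where K: "k1 < K" "K \<in> \<rat>"
    using Rats_dense_in_real[of k1 "k1 + 1"] by auto
  have "measure \<nu> {k1<..} < 1 - r"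
    using k0[of k1] k1 by (simp add: nu.tail_eq_cdf)
  from order_tendstoD(2)[OF tail[OF k1(2)] this] obtain t0
    where t0: "\<And>t. t \<ge> t0 \<Longrightarrow> real (above k1 t) / real (sz t) < 1 - r"
    by (auto simp: eventually_at_top_linorder)
  have low: "r * real (size (admitted r x y t)) \<le> real (size {#a \<in># admitted r x y t. a \<le> K#})"
    if "t \<ge> max 1 t0" for t
  proof -
    have "real (above K t) \<le> real (above k1 t)" using above_anti K by simp
    also have "\<dots> < (1 - r) * real (sz t)"
      using t0[of t] sz_pos[of t] that by (simp add: divide_less_eq)
    finally have "r * real (sz t) < real (sz t) - real (above K t)" by (simp add: algebra_simps)
    moreover have "sz t = size {#a \<in># admitted r x y t. a \<le> K#} + above K t"
      using multiset_partition[of "admitted r x y t" "\<lambda>a. a \<le> K"]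
      by (simp add: sz_def above_def not_le flip: size_union)
    ultimately show ?thesis by (simp add: sz_def)
  qed
  define T where "T = max 1 t0"
  have above_ge: "hits q t \<le> above q t + T" if "K \<le> q" for q t
    unfolding hits_def above_def T_def by (rule size_admitted_above_ge[OF low that])
  have shift: "(\<lambda>t. (real (hits q t) - real T) / real t) \<longlonglongrightarrow> (G q)\<^sup>2" if "q \<in> \<rat>" for q
    using tendsto_diff[OF hits[OF that] lim_const_over_n[of "real T"]] by (simp add: diff_divide_distrib)

  \<comment> \<open>The tail count \<open>above w t\<close> is divided by \<open>sz t\<close>, which satisfies \<open>hits K t - T \<le> sz t \<le> t\<close>.\<close>
  define C where "C = 1 / (G K)\<^sup>2"
  have lower: "(G q)\<^sup>2 \<le> measure \<nu> {w<..}" if "q \<in> \<rat>" "K \<le> q" "w \<le> q" "isCont (cdf \<nu>) w" for q w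
  proof (rule tendsto_le[OF _ tail[OF that(4)] shift[OF that(1)]])
    show "\<forall>\<^sub>F t in sequentially. (real (hits q t) - real T) / real t \<le> real (above w t) / real (sz t)"
      using eventually_gt_at_top[of 0]
    proof eventually_elim
      case (elim t)
      have "(real (hits q t) - real T) / real t \<le> real (above w t) / real t"
        using above_ge[OF that(2), of t] above_anti[OF that(3), of t] by (intro divide_right_mono) auto
      also have "\<dots> \<le> real (above w t) / real (sz t)"
        using sz_le[of t] sz_pos[OF elim] by (intro divide_left_mono) auto
      finally show ?case .
    qed
  qed simp
  have upper: "measure \<nu> {w<..} \<le> C * (G q)\<^sup>2" if "q \<in> \<rat>" "q \<le> w" "isCont (cdf \<nu>) w" for q w
  proof (rule tendsto_le[OF _ _ tail[OF that(3)]])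
    have "(\<lambda>t. (real (hits q t) / real t) / ((real (hits K t) - real T) / real t)) \<longlonglongrightarrow> (G q)\<^sup>2 / (G K)\<^sup>2"
      using G_pos[of K] by (intro tendsto_divide hits shift that K) auto
    then show "(\<lambda>t. (real (hits q t) / real t) / ((real (hits K t) - real T) / real t)) \<longlonglongrightarrow> C * (G q)\<^sup>2"
      by (simp add: C_def)
    have "\<forall>\<^sub>F t in sequentially. (real (hits K t) - real T) / real t > 0"
      using order_tendstoD(1)[OF shift[OF K(2)], of 0] G_pos[of K] by simp
    then show "\<forall>\<^sub>F t in sequentially. real (above w t) / real (sz t)
        \<le> (real (hits q t) / real t) / ((real (hits K t) - real T) / real t)"
      using eventually_gt_at_top[of 0]
    proof eventually_elim
      case (elim t)
      have pos: "real (hits K t) - real T > 0"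
        using elim by (simp add: zero_less_divide_iff)
      have "real (above w t) \<le> real (hits q t)"
        using above_le[of q t] above_anti[OF that(2), of t] by simp
      moreover have "real (hits K t) - real T \<le> real (sz t)"
        using above_ge[of K t] above_sz[of K t] by simp
      ultimately have "real (above w t) / real (sz t) \<le> real (hits q t) / (real (hits K t) - real T)"
        using pos by (intro frac_le) auto
      then show ?case using elim by simp
    qed
  qed simp

  show thesis
  proof
    show "C > 0" using G_pos[of K] by (simp add: C_def)
    fix u assume "K \<le> u"
    show "(G u)\<^sup>2 \<le> measure \<nu> {u<..}"
    proof (rule tendsto_upperbound[OF tendsto_power[OF G_right]])
      show "\<forall>\<^sub>F v in at_right u. (G v)\<^sup>2 \<le> measure \<nu> {u<..}"
        unfolding eventually_at_filter
      proof (intro always_eventually allI impI)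
        fix v assume "v \<noteq> u" "v \<in> {u<..}"
        then obtain q where q: "u < q" "q < v" "q \<in> \<rat>" using Rats_dense_in_real by auto
        obtain w where w: "u < w" "w < q" "isCont (cdf \<nu>) w"
          using nu.ex_isCont_cdf_between[OF q(1)] .
        have "(G v)\<^sup>2 \<le> (G q)\<^sup>2"
          using G_anti[of q v] G_pos[of v] q by (intro power_mono) auto
        also have "\<dots> \<le> measure \<nu> {w<..}" using lower q w \<open>K \<le> u\<close> by auto
        also have "\<dots> \<le> measure \<nu> {u<..}" using nu.tail_antimono w by simp
        finally show "(G v)\<^sup>2 \<le> measure \<nu> {u<..}" .
      qed
    qed simp
    show "measure \<nu> {u<..} \<le> C * (G u)\<^sup>2"
    proof (rule tendsto_upperbound[OF nu.tail_at_right])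
      show "\<forall>\<^sub>F v in at_right u. measure \<nu> {v<..} \<le> C * (G u)\<^sup>2"
        unfolding eventually_at_filter
      proof (intro always_eventually allI impI)
        fix v assume "v \<noteq> u" "v \<in> {u<..}"
        then obtain q where q: "u < q" "q < v" "q \<in> \<rat>" using Rats_dense_in_real by auto
        obtain w where w: "q < w" "w < v" "isCont (cdf \<nu>) w"
          using nu.ex_isCont_cdf_between[OF q(2)] .
        have "measure \<nu> {v<..} \<le> measure \<nu> {w<..}" using nu.tail_antimono w by simp
        also have "\<dots> \<le> C * (G q)\<^sup>2" using upper q w by auto
        also have "\<dots> \<le> C * (G u)\<^sup>2"
          using G_anti[of u q] G_pos[of q] q \<open>C > 0\<close> by (intro mult_left_mono power_mono) auto
        finally show "measure \<nu> {v<..} \<le> C * (G u)\<^sup>2" .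
      qed
    qed simp
  qed
qed

section \<open>The logarithmic tail ratio\<close>

text \<open>
  A constant factor changes \<open>ln (H u)\<close> by a bounded amount, which vanishes after division by
  \<open>ln (G u) \<longlonglongrightarrow> -\<infinity>\<close>.
\<close>

lemma ln_ratio_tendsto_two:
  fixes G H :: "real \<Rightarrow> real"
  assumes "(G \<longlongrightarrow> 0) at_top" and G_pos: "\<And>u. 0 < G u" and "C > 0"
    and lower: "\<And>u. K \<le> u \<Longrightarrow> (G u)\<^sup>2 \<le> H u"
    and upper: "\<And>u. K \<le> u \<Longrightarrow> H u \<le> C * (G u)\<^sup>2"
  shows "((\<lambda>u. ln (H u) / ln (G u)) \<longlongrightarrow> 2) at_top"
proof (rule tendsto_sandwich)
  have "filterlim G (at_right 0) at_top"
    using assms(1) G_pos by (intro tendsto_imp_filterlim_at_right) auto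
  then have "filterlim (\<lambda>u. ln (G u)) at_bot at_top"
    by (rule filterlim_compose[OF ln_at_0])
  then have "((\<lambda>u. ln C / ln (G u)) \<longlongrightarrow> 0) at_top"
    by (intro tendsto_divide_0[OF tendsto_const] filterlim_at_bot_imp_at_infinity)
  from tendsto_add[OF tendsto_const[of 2] this]
  show "((\<lambda>u. 2 + ln C / ln (G u)) \<longlongrightarrow> 2) at_top" by simp
  have ev: "\<forall>\<^sub>F u in at_top. G u < 1 \<and> K \<le> u"
    using order_tendstoD(2)[OF assms(1), of 1] eventually_ge_at_top[of K]
    by (auto intro: eventually_conj)
  show "\<forall>\<^sub>F u in at_top. ln (H u) / ln (G u) \<le> 2"
    using ev
  proof eventually_elim
    case (elim u)
    have "ln ((G u)\<^sup>2) \<le> ln (H u)" 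
      using lower[of u] elim G_pos[of u]
      by (subst ln_le_cancel_iff) (auto intro: less_le_trans[of _ "(G u)\<^sup>2"])
    then show ?case
      using elim G_pos[of u] by (simp add: ln_realpow divide_le_eq)
  qed
  show "\<forall>\<^sub>F u in at_top. 2 + ln C / ln (G u) \<le> ln (H u) / ln (G u)"
    using ev
  proof eventually_elim
    case (elim u)
    have "0 < (G u)\<^sup>2" using G_pos[of u] by simp
    then have "0 < H u" using lower[of u] elim by linarith
    then have "ln (H u) \<le> ln (C * (G u)\<^sup>2)"
      using upper[of u] elim G_pos[of u] \<open>C > 0\<close> by (subst ln_le_cancel_iff) auto
    also have "\<dots> = ln C + 2 * ln (G u)"
      using G_pos[of u] \<open>C > 0\<close> by (simp add: ln_mult ln_realpow)
    finally have "(ln C + 2 * ln (G u)) / ln (G u) \<le> ln (H u) / ln (G u)"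
      using elim G_pos[of u] by (intro divide_right_mono_neg) auto
    then show ?case
      using elim G_pos[of u] by (simp add: add_divide_distrib)
  qed
qed simp

theorem corollary1p2:
  fixes M :: "'a measure" and X Y :: "nat \<Rightarrow> 'a \<Rightarrow> real"
    and \<mu> :: "real measure" and r :: real and \<nu> :: "'a \<Rightarrow> real measure"
  assumes "prob_space M"
    and "real_distribution \<mu>" and "AE x in \<mu>. 0 \<le> x" and "mu_max \<mu> = \<infinity>"
    and "0 < r" and "r < 1"
    and "prob_space.indep_vars M (\<lambda>_. borel \<Otimes>\<^sub>M borel) (\<lambda>t \<omega>. (X t \<omega>, Y t \<omega>)) {1..}"
    and "\<And>t. t \<ge> 1 \<Longrightarrow> prob_space.indep_var M borel (X t) borel (Y t)"
    and "\<And>t. t \<ge> 1 \<Longrightarrow> distr M borel (X t) = \<mu>"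
    and "\<And>t. t \<ge> 1 \<Longrightarrow> distr M borel (Y t) = \<mu>"
    and "AE \<omega> in M. real_distribution (\<nu> \<omega>) \<and>
           weak_conv_m (\<lambda>t. empirical (admitted r (\<lambda>n. X n \<omega>) (\<lambda>n. Y n \<omega>) t)) (\<nu> \<omega>)"
  shows "AE \<omega> in M.
           ((\<lambda>s. ln (measure (\<nu> \<omega>) {s<..}) / ln (measure \<mu> {s<..})) \<longlongrightarrow> 2) at_top"
proof -
  interpret prob_space M by fact
  interpret mu: real_distribution \<mu> by fact
  let ?G = "\<lambda>u. measure \<mu> {u<..}"
  have "AE \<omega> in M. \<forall>q\<in>\<rat>.
      (\<lambda>t. real (card {i \<in> {1..t}. q < min (X i \<omega>) (Y i \<omega>)}) / real t) \<longlonglongrightarrow> (?G q)\<^sup>2"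
    unfolding AE_ball_countable[OF countable_rat]
  proof
    fix q :: real
    have "prob {\<omega> \<in> space M. (X i \<omega>, Y i \<omega>) \<in> {q<..} \<times> {q<..}} = (?G q)\<^sup>2" if "i \<ge> 1" for i
      using prob_min_greater[OF assms(8-10)[OF that], of q] by simp
    from strong_law_relative_frequency[OF assms(7) _ this]
    show "AE \<omega> in M.
        (\<lambda>t. real (card {i \<in> {1..t}. q < min (X i \<omega>) (Y i \<omega>)}) / real t) \<longlonglongrightarrow> (?G q)\<^sup>2"
      by simp
  qed
  with assms(11) show ?thesis
  proof eventually_elim
    case (elim \<omega>)
    then have "real_distribution (\<nu> \<omega>)"
      "weak_conv_m (\<lambda>t. empirical (admitted r (\<lambda>n. X n \<omega>) (\<lambda>n. Y n \<omega>) t)) (\<nu> \<omega>)"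
      by blast+
    then show ?case
    proof (rule limit_tail_comparable[OF _ _ \<open>r < 1\<close>])
      show "(\<lambda>t. real (card {i \<in> {1..t}. q < min (X i \<omega>) (Y i \<omega>)}) / real t) \<longlonglongrightarrow> (?G q)\<^sup>2"
        if "q \<in> \<rat>" for q
        using elim that by blast
      show "0 < ?G u" for u
        by (rule tail_pos_of_mu_max[OF assms(4,2)])
      show "(?G \<longlongrightarrow> ?G u) (at_right u)" for u
        by (rule mu.tail_at_right)
      show "?G v \<le> ?G u" if "u \<le> v" for u v
        by (rule mu.tail_antimono[OF that])
      show "((\<lambda>s. ln (measure (\<nu> \<omega>) {s<..}) / ln (?G s)) \<longlongrightarrow> 2) at_top"
        if "0 < C" "\<And>u. K \<le> u \<Longrightarrow> (?G u)\<^sup>2 \<le> measure (\<nu> \<omega>) {u<..}"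
          "\<And>u. K \<le> u \<Longrightarrow> measure (\<nu> \<omega>) {u<..} \<le> C * (?G u)\<^sup>2" for K C
        by (rule ln_ratio_tendsto_two[OF mu.tail_at_top tail_pos_of_mu_max[OF assms(4,2)] that])
    qed
  qed
qed

end
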